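(* Let $A$ and $B$ be $n$-dimensional pre-Lie algebras over a field $K$, and let $\mathfrak{g}_A$ and $\mathfrak{g}_B$ be their associated Lie algebras. If $A$ degenerates to $B$ (as pre-Lie algebras), then $\mathfrak{g}_A$ degenerates to $\mathfrak{g}_B$ (as Lie algebras).
   Context: A pre-Lie algebra over a field $K$ is a $K$-vector space with a bilinear product satisfying $(x\cdot y)\cdot z-x\cdot(y\cdot z)=(y\cdot x)\cdot z-y\cdot(x\cdot z)$ for all $x,y,z$. The commutator $[x,y]=x\cdot y-y\cdot x$ is then a Lie bracket on $A$; the resulting Lie algebra is denoted $\mathfrak{g}_A$. Fix an $n$-dimensional $K$-vector space $V$ with basis $(e_1,\dots,e_n)$. $\mathcal{P}_n(K)\subseteq K^{n^3}$ is the affine algebraic set of all structure constants $(c_{ij}^k)$ of pre-Lie algebra products $e_i\cdot e_j=\sum_k c_{ij}^k e_k$ on $V$, and $\mathcal{L}_n(K)\subseteq K^{n^3}$ is the analogous variety of structure constants of Lie brackets on $V$. $GL_n(K)$ acts on both by $(g\circ\mu)(x,y)=g(\mu(g^{-1}x,g^{-1}y))$; orbits correspond to isomorphism classes. $O(\mu)$ is the orbit of $\mu$ and $\overline{O(\mu)}$ its Zariski closure. In either variety, $\lambda$ degenerates to $\mu$ if $\mu\in\overline{O(\lambda)}$, and an algebra $A$ degenerates to $B$ if a structure representing $A$ degenerates to one representing $B$. *)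

theory Defs
  imports Complex_Main "HOL-Library.Poly_Mapping"
begin

section \<open>Pre-Lie algebras and Lie algebras\<close>

locale nonassoc_algebra = vector_space scale
  for scale :: "'k::field \<Rightarrow> 'a::ab_group_add \<Rightarrow> 'a" +
  fixes mult :: "'a \<Rightarrow> 'a \<Rightarrow> 'a"
  assumes linear_mult_right: "Vector_Spaces.linear scale scale (\<lambda>y. mult x y)"
    and linear_mult_left: "Vector_Spaces.linear scale scale (\<lambda>x. mult x y)"

locale pre_lie_algebra = nonassoc_algebra +
  assumes pre_lie: "mult (mult x y) z - mult x (mult y z) = mult (mult y x) z - mult y (mult x z)"

locale lie_algebra = nonassoc_algebra +
  assumes alternating: "mult x x = 0"
    and jacobi: "mult x (mult y z) + mult y (mult z x) + mult z (mult x y) = 0"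

definition commutator :: "('a::ab_group_add \<Rightarrow> 'a \<Rightarrow> 'a) \<Rightarrow> 'a \<Rightarrow> 'a \<Rightarrow> 'a" where
  "commutator mult x y = mult x y - mult y x"

definition n_dimensional :: "nat \<Rightarrow> ('k::field \<Rightarrow> 'a::ab_group_add \<Rightarrow> 'a) \<Rightarrow> bool" where
  "n_dimensional n scale \<longleftrightarrow> (\<exists>B. finite_dimensional_vector_space scale B \<and> card B = n)"


section \<open>The Zariski topology on an affine space\<close>

text \<open>
  For a set \<open>I\<close>, the space \<open>K\<^sup>I\<close> consists of the functions that vanish outside \<open>I\<close>. A polynomial
  is a finitely supported map from monomials to coefficients, a monomial being a finitely
  supported map from variables to exponents.
\<close>

definition affine_space :: "'i set \<Rightarrow> ('i \<Rightarrow> 'k::zero) set" where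
  "affine_space I = {c. \<forall>i. i \<notin> I \<longrightarrow> c i = 0}"

definition polynomials :: "'i set \<Rightarrow> (('i \<Rightarrow>\<^sub>0 nat) \<Rightarrow>\<^sub>0 'k::field) set" where
  "polynomials I = {p. \<forall>m \<in> Poly_Mapping.keys p. Poly_Mapping.keys m \<subseteq> I}"

definition poly_eval :: "(('i \<Rightarrow>\<^sub>0 nat) \<Rightarrow>\<^sub>0 'k::field) \<Rightarrow> ('i \<Rightarrow> 'k) \<Rightarrow> 'k" where
  "poly_eval p c =
    (\<Sum>m \<in> Poly_Mapping.keys p.
      Poly_Mapping.lookup p m * (\<Prod>i \<in> Poly_Mapping.keys m. c i ^ Poly_Mapping.lookup m i))"

definition zariski_closed :: "'i set \<Rightarrow> ('i \<Rightarrow> 'k::field) set \<Rightarrow> bool" where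
  "zariski_closed I Z \<longleftrightarrow>
    (\<exists>P \<subseteq> polynomials I. Z = {c \<in> affine_space I. \<forall>p \<in> P. poly_eval p c = 0})"

definition zariski_closure :: "'i set \<Rightarrow> ('i \<Rightarrow> 'k::field) set \<Rightarrow> ('i \<Rightarrow> 'k) set" where
  "zariski_closure I S = zariski_closed I hull S"


section \<open>Structure constants and degenerations\<close>

locale based_vector_space = vector_space scale
  for scale :: "'k::field \<Rightarrow> 'v::ab_group_add \<Rightarrow> 'v" +
  fixes n :: nat and e :: "nat \<Rightarrow> 'v"
  assumes inj_basis: "inj_on e {1..n}"
    and independent_basis: "independent (e ` {1..n})"
    and span_basis: "span (e ` {1..n}) = UNIV"
begin

definition coord :: "'v \<Rightarrow> nat \<Rightarrow> 'k" where
  "coord x i = representation (e ` {1..n}) x (e i)"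

definition indices :: "(nat \<times> nat \<times> nat) set" where
  "indices = {1..n} \<times> {1..n} \<times> {1..n}"

text \<open>The entry of a point of \<open>K\<^sup>I\<close> at \<open>(i, j, k)\<close>, with \<open>I = indices\<close>, is the structure constant
  usually written with lower indices \<open>i\<close>, \<open>j\<close> and upper index \<open>k\<close>.\<close>

definition structure_constants :: "('v \<Rightarrow> 'v \<Rightarrow> 'v) \<Rightarrow> nat \<times> nat \<times> nat \<Rightarrow> 'k" where
  "structure_constants \<mu> =
    (\<lambda>(i, j, k). if (i, j, k) \<in> indices then coord (\<mu> (e i) (e j)) k else 0)"

text \<open>The bilinear extension of \<open>e\<^sub>i \<cdot> e\<^sub>j = \<Sum>\<^sub>k c (i, j, k) e\<^sub>k\<close>.\<close>

definition product_of :: "(nat \<times> nat \<times> nat \<Rightarrow> 'k) \<Rightarrow> 'v \<Rightarrow> 'v \<Rightarrow> 'v" where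
  "product_of c x y =
    (\<Sum>i = 1..n. \<Sum>j = 1..n. \<Sum>k = 1..n. scale (coord x i * coord y j * c (i, j, k)) (e k))"

definition pre_lie_variety :: "(nat \<times> nat \<times> nat \<Rightarrow> 'k) set" where
  "pre_lie_variety = {c \<in> affine_space indices. pre_lie_algebra scale (product_of c)}"

definition lie_variety :: "(nat \<times> nat \<times> nat \<Rightarrow> 'k) set" where
  "lie_variety = {c \<in> affine_space indices. lie_algebra scale (product_of c)}"

text \<open>The group \<open>GL\<^sub>n(K)\<close> is identified with the group of linear automorphisms of the space
  via the basis \<open>e\<close>.\<close>

definition GL :: "('v \<Rightarrow> 'v) set" where
  "GL = {g. Vector_Spaces.linear scale scale g \<and> bij g}"

definition act :: "('v \<Rightarrow> 'v) \<Rightarrow> (nat \<times> nat \<times> nat \<Rightarrow> 'k) \<Rightarrow> nat \<times> nat \<times> nat \<Rightarrow> 'k" where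
  "act g c = structure_constants (\<lambda>x y. g (product_of c (inv g x) (inv g y)))"

definition orbit :: "(nat \<times> nat \<times> nat \<Rightarrow> 'k) \<Rightarrow> (nat \<times> nat \<times> nat \<Rightarrow> 'k) set" where
  "orbit c = (\<lambda>g. act g c) ` GL"

definition degenerates_in ::
  "(nat \<times> nat \<times> nat \<Rightarrow> 'k) set \<Rightarrow> (nat \<times> nat \<times> nat \<Rightarrow> 'k) \<Rightarrow> (nat \<times> nat \<times> nat \<Rightarrow> 'k) \<Rightarrow> bool" where
  "degenerates_in X c d \<longleftrightarrow> c \<in> X \<and> d \<in> X \<and> d \<in> zariski_closure indices (orbit c)"

definition represents ::
  "(nat \<times> nat \<times> nat \<Rightarrow> 'k) \<Rightarrow> ('k \<Rightarrow> 'a::ab_group_add \<Rightarrow> 'a) \<Rightarrow> ('a \<Rightarrow> 'a \<Rightarrow> 'a) \<Rightarrow> bool" where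
  "represents c scaleA multA \<longleftrightarrow>
    (\<exists>f. Vector_Spaces.linear scaleA scale f \<and> bij f \<and>
      (\<forall>x y. f (multA x y) = product_of c (f x) (f y)))"

definition algebra_degenerates_in ::
  "(nat \<times> nat \<times> nat \<Rightarrow> 'k) set \<Rightarrow>
   ('k \<Rightarrow> 'a::ab_group_add \<Rightarrow> 'a) \<Rightarrow> ('a \<Rightarrow> 'a \<Rightarrow> 'a) \<Rightarrow>
   ('k \<Rightarrow> 'b::ab_group_add \<Rightarrow> 'b) \<Rightarrow> ('b \<Rightarrow> 'b \<Rightarrow> 'b) \<Rightarrow> bool" where
  "algebra_degenerates_in X scaleA multA scaleB multB \<longleftrightarrow>
    (\<exists>c d. represents c scaleA multA \<and> represents d scaleB multB \<and> degenerates_in X c d)"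

definition pre_lie_degenerates ::
  "('k \<Rightarrow> 'a::ab_group_add \<Rightarrow> 'a) \<Rightarrow> ('a \<Rightarrow> 'a \<Rightarrow> 'a) \<Rightarrow>
   ('k \<Rightarrow> 'b::ab_group_add \<Rightarrow> 'b) \<Rightarrow> ('b \<Rightarrow> 'b \<Rightarrow> 'b) \<Rightarrow> bool" where
  "pre_lie_degenerates = algebra_degenerates_in pre_lie_variety"

definition lie_degenerates ::
  "('k \<Rightarrow> 'a::ab_group_add \<Rightarrow> 'a) \<Rightarrow> ('a \<Rightarrow> 'a \<Rightarrow> 'a) \<Rightarrow>
   ('k \<Rightarrow> 'b::ab_group_add \<Rightarrow> 'b) \<Rightarrow> ('b \<Rightarrow> 'b \<Rightarrow> 'b) \<Rightarrow> bool" where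
  "lie_degenerates = algebra_degenerates_in lie_variety"

end

end

theory Submission
  imports Defs
begin

text \<open>
  On structure constants, passing from a pre-Lie product to its commutator is the linear map
  sending \<open>c\<close> to \<open>c (i, j, k) - c (j, i, k)\<close>. It takes pre-Lie structures to Lie structures, and
  it commutes with the action of \<open>GL\<^sub>n(K)\<close> because a change of basis is linear and so respects
  differences; hence it maps the orbit of \<open>c\<close> into the orbit of its image
  (\<open>commutator_constants_orbit\<close>).
  Being given by polynomials, it is also continuous for the Zariski topology
  (\<open>polynomial_map_zariski_closure\<close>), so it maps the closure of the first orbit into the closure of
  the second. This is the asserted degeneration.

  The continuity needs that substituting polynomials into a polynomial gives a polynomial. That is
  shown at the level of polynomial functions, which makes it unnecessary to form the substituted
  polynomial explicitly.
\<close>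

section \<open>Polynomial functions\<close>

definition polynomial_functions :: "'i set \<Rightarrow> (('i \<Rightarrow> 'k::field) \<Rightarrow> 'k) set" where
  "polynomial_functions I = poly_eval ` polynomials I"

definition monomial_eval :: "('i \<Rightarrow>\<^sub>0 nat) \<Rightarrow> ('i \<Rightarrow> 'k::field) \<Rightarrow> 'k" where
  "monomial_eval m c = (\<Prod>i \<in> Poly_Mapping.keys m. c i ^ Poly_Mapping.lookup m i)"

text \<open>
  Enlarging the index sets makes the evaluations of several polynomials or monomials range over
  one common set: the additional terms are \<open>0\<close>, respectively the additional factors are \<open>1\<close>.
\<close>

lemma poly_eval_superset:
  assumes "finite S" "Poly_Mapping.keys p \<subseteq> S"
  shows "poly_eval p c = (\<Sum>m \<in> S. Poly_Mapping.lookup p m * monomial_eval m c)"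
  unfolding poly_eval_def monomial_eval_def
  using assms by (intro sum.mono_neutral_left) (auto simp: in_keys_iff)

lemma monomial_eval_superset:
  assumes "finite S" "Poly_Mapping.keys m \<subseteq> S"
  shows "monomial_eval m c = (\<Prod>i \<in> S. c i ^ Poly_Mapping.lookup m i)"
  unfolding monomial_eval_def
  using assms by (intro prod.mono_neutral_left) (auto simp: in_keys_iff)

lemma poly_eval_add: "poly_eval (p + q) c = poly_eval p c + poly_eval q c"
proof -
  let ?S = "Poly_Mapping.keys p \<union> Poly_Mapping.keys q"
  have "Poly_Mapping.keys (p + q) \<subseteq> ?S"
    by (rule keys_add)
  then show ?thesis
    by (simp add: poly_eval_superset[of ?S] lookup_add distrib_right sum.distrib)
qed

lemma monomial_eval_add: "monomial_eval (m + m') c = monomial_eval m c * monomial_eval m' c"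
proof -
  let ?S = "Poly_Mapping.keys m \<union> Poly_Mapping.keys m'"
  have "Poly_Mapping.keys (m + m') \<subseteq> ?S"
    by (rule keys_add)
  then show ?thesis
    by (simp add: monomial_eval_superset[of ?S] lookup_add power_add prod.distrib)
qed

lemma polynomial_functions_monomial:
  assumes "Poly_Mapping.keys m \<subseteq> I"
  shows "(\<lambda>c. a * monomial_eval m c) \<in> polynomial_functions I"
proof -
  have "poly_eval (Poly_Mapping.single m a) = (\<lambda>c. a * monomial_eval m c)"
    by (rule ext) (simp add: poly_eval_superset[of "{m}"])
  moreover have "Poly_Mapping.single m a \<in> polynomials I"
    using assms by (auto simp: polynomials_def)
  ultimately show ?thesis
    unfolding polynomial_functions_def by (metis image_eqI)
qed

lemma polynomial_functions_const: "(\<lambda>c. a) \<in> polynomial_functions I"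
  using polynomial_functions_monomial[of 0 I a] by (simp add: monomial_eval_def)

lemma polynomial_functions_var:
  assumes "i \<in> I"
  shows "(\<lambda>c. c i) \<in> polynomial_functions I"
  using polynomial_functions_monomial[of "Poly_Mapping.single i 1" I 1] assms
  by (simp add: monomial_eval_def)

lemma polynomial_functions_add:
  assumes "f \<in> polynomial_functions I" "g \<in> polynomial_functions I"
  shows "(\<lambda>c. f c + g c) \<in> polynomial_functions I"
proof -
  obtain p q where "p \<in> polynomials I" "f = poly_eval p" "q \<in> polynomials I" "g = poly_eval q"
    using assms by (auto simp: polynomial_functions_def)
  moreover from this have "p + q \<in> polynomials I"
    using keys_add[of p q] by (auto simp: polynomials_def)
  moreover have "poly_eval (p + q) = (\<lambda>c. poly_eval p c + poly_eval q c)"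
    by (rule ext) (rule poly_eval_add)
  ultimately show ?thesis
    unfolding polynomial_functions_def by (metis image_eqI)
qed

lemma polynomial_functions_sum:
  assumes "\<And>x. x \<in> X \<Longrightarrow> f x \<in> polynomial_functions I"
  shows "(\<lambda>c. \<Sum>x \<in> X. f x c) \<in> polynomial_functions I"
  using assms
  by (induction X rule: infinite_finite_induct)
    (auto intro: polynomial_functions_const polynomial_functions_add)

text \<open>Expanding both factors into monomials leaves a finite double sum of monomial functions.\<close>

lemma polynomial_functions_mult:
  assumes "f \<in> polynomial_functions I" "g \<in> polynomial_functions I"
  shows "(\<lambda>c. f c * g c) \<in> polynomial_functions I"
proof -
  obtain p q where p: "p \<in> polynomials I" "f = poly_eval p"
    and q: "q \<in> polynomials I" "g = poly_eval q"
    using assms by (auto simp: polynomial_functions_def)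
  have "(\<lambda>c. \<Sum>m \<in> Poly_Mapping.keys p. \<Sum>m' \<in> Poly_Mapping.keys q.
      (Poly_Mapping.lookup p m * Poly_Mapping.lookup q m') * monomial_eval (m + m') c)
      \<in> polynomial_functions I"
  proof (intro polynomial_functions_sum polynomial_functions_monomial)
    fix m m' assume "m \<in> Poly_Mapping.keys p" "m' \<in> Poly_Mapping.keys q"
    with p q show "Poly_Mapping.keys (m + m') \<subseteq> I"
      using keys_add[of m m'] unfolding polynomials_def by blast
  qed
  moreover have "f c * g c = (\<Sum>m \<in> Poly_Mapping.keys p. \<Sum>m' \<in> Poly_Mapping.keys q.
      (Poly_Mapping.lookup p m * Poly_Mapping.lookup q m') * monomial_eval (m + m') c)" for c
    by (simp add: p q poly_eval_superset[OF finite_keys order_refl] sum_product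
        monomial_eval_add mult_ac)
  ultimately show ?thesis
    by simp
qed

lemma polynomial_functions_prod:
  assumes "\<And>x. x \<in> X \<Longrightarrow> f x \<in> polynomial_functions I"
  shows "(\<lambda>c. \<Prod>x \<in> X. f x c) \<in> polynomial_functions I"
  using assms
  by (induction X rule: infinite_finite_induct)
    (auto intro: polynomial_functions_const polynomial_functions_mult)

lemma polynomial_functions_power:
  assumes "f \<in> polynomial_functions I"
  shows "(\<lambda>c. f c ^ r) \<in> polynomial_functions I"
  using polynomial_functions_prod[of "{..<r}" "\<lambda>_. f" I] assms by simp

lemma polynomial_functions_compose:
  assumes "f \<in> polynomial_functions I"
    and coordinates: "\<And>i. i \<in> I \<Longrightarrow> (\<lambda>c. \<phi> c i) \<in> polynomial_functions J"
  shows "(\<lambda>c. f (\<phi> c)) \<in> polynomial_functions J"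
proof -
  obtain p where p: "p \<in> polynomials I" "f = poly_eval p"
    using assms by (auto simp: polynomial_functions_def)
  show ?thesis
    unfolding p(2) poly_eval_def
    using p(1) unfolding polynomials_def
    by (intro polynomial_functions_sum polynomial_functions_mult polynomial_functions_const
        polynomial_functions_prod polynomial_functions_power coordinates) auto
qed


section \<open>Zariski continuity of polynomial maps\<close>

lemma zariski_closed_preimage:
  assumes "zariski_closed I Z"
    and into: "\<And>c. c \<in> affine_space J \<Longrightarrow> \<phi> c \<in> affine_space I"
    and coordinates: "\<And>i. i \<in> I \<Longrightarrow> (\<lambda>c. \<phi> c i) \<in> polynomial_functions J"
  shows "zariski_closed J {c \<in> affine_space J. \<phi> c \<in> Z}"
proof -
  obtain P where P: "P \<subseteq> polynomials I"
    and Z: "Z = {c \<in> affine_space I. \<forall>p \<in> P. poly_eval p c = 0}"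
    using assms(1) by (auto simp: zariski_closed_def)
  have "\<exists>q. q \<in> polynomials J \<and> poly_eval q = (\<lambda>c. poly_eval p (\<phi> c))" if "p \<in> P" for p
  proof -
    have "poly_eval p \<in> polynomial_functions I"
      using P that by (auto simp: polynomial_functions_def)
    then have "(\<lambda>c. poly_eval p (\<phi> c)) \<in> polynomial_functions J"
      by (rule polynomial_functions_compose) (rule coordinates)
    then show ?thesis
      by (auto simp: polynomial_functions_def)
  qed
  then obtain Q where Q: "\<And>p. p \<in> P \<Longrightarrow> Q p \<in> polynomials J"
      "\<And>p. p \<in> P \<Longrightarrow> poly_eval (Q p) = (\<lambda>c. poly_eval p (\<phi> c))"
    by metis
  have "{c \<in> affine_space J. \<phi> c \<in> Z} = {c \<in> affine_space J. \<forall>q \<in> Q ` P. poly_eval q c = 0}"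
    using into Q(2) by (auto simp: Z)
  moreover have "Q ` P \<subseteq> polynomials J"
    using Q(1) by auto
  ultimately show ?thesis
    unfolding zariski_closed_def by blast
qed

text \<open>
  The preimage of a closed set containing \<open>\<phi> ` S\<close> is itself closed and contains \<open>S\<close>, hence its
  closure.
\<close>

lemma polynomial_map_zariski_closure:
  assumes "d \<in> zariski_closure J S" and "S \<subseteq> affine_space J"
    and into: "\<And>c. c \<in> affine_space J \<Longrightarrow> \<phi> c \<in> affine_space I"
    and coordinates: "\<And>i. i \<in> I \<Longrightarrow> (\<lambda>c. \<phi> c i) \<in> polynomial_functions J"
  shows "\<phi> d \<in> zariski_closure I (\<phi> ` S)"
  unfolding zariski_closure_def hull_def
proof (intro InterI, clarify)
  fix Z assume "zariski_closed I Z" "\<phi> ` S \<subseteq> Z"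
  then have "zariski_closed J {c \<in> affine_space J. \<phi> c \<in> Z}"
    and "S \<subseteq> {c \<in> affine_space J. \<phi> c \<in> Z}"
    using zariski_closed_preimage[OF _ into coordinates] assms(2) by auto
  then show "\<phi> d \<in> Z"
    using assms(1) unfolding zariski_closure_def hull_def by blast
qed


section \<open>The commutator of a pre-Lie product\<close>

text \<open>
  Expanding the Jacobi sum of the commutator gives twelve triple products, which group into three
  instances of the pre-Lie identity, one for each cyclic rotation of the arguments.
\<close>

lemma (in pre_lie_algebra) lie_algebra_commutator: "lie_algebra scale (commutator mult)"
proof -
  interpret vector_space_pair scale scale
    by unfold_locales
  have right_diff: "mult x (y - z) = mult x y - mult x z" for x y z
    using linear_mult_right by (rule linear_diff)
  have left_diff: "mult (x - y) z = mult x z - mult y z" for x y z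
    using linear_mult_left by (rule linear_diff)
  show ?thesis
  proof (intro lie_algebra.intro nonassoc_algebra.intro nonassoc_algebra_axioms.intro
      lie_algebra_axioms.intro)
    show "vector_space scale"
      by unfold_locales
  next
    fix x y z
    show "commutator mult x x = 0"
      by (simp add: commutator_def)
    let ?D = "\<lambda>x y z. mult (mult x y) z - mult x (mult y z)
      - (mult (mult y x) z - mult y (mult x z))"
    have "commutator mult x (commutator mult y z) + commutator mult y (commutator mult z x)
        + commutator mult z (commutator mult x y) = - (?D x y z + ?D y z x + ?D z x y)"
      by (simp add: commutator_def right_diff left_diff)
    also have "?D x y z + ?D y z x + ?D z x y = 0"
      using pre_lie[of x y z] pre_lie[of y z x] pre_lie[of z x y] by simp
    finally show "commutator mult x (commutator mult y z) + commutator mult y (commutator mult z x)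
        + commutator mult z (commutator mult x y) = 0"
      by simp
  next
    show "Vector_Spaces.linear scale scale (\<lambda>y. commutator mult x y)" for x
      unfolding commutator_def
      by (intro linear_compose_sub linear_mult_left linear_mult_right)
    show "Vector_Spaces.linear scale scale (\<lambda>x. commutator mult x y)" for y
      unfolding commutator_def
      by (intro linear_compose_sub linear_mult_left linear_mult_right)
  qed
qed


section \<open>The commutator on structure constants and degenerations\<close>

definition commutator_constants :: "(nat \<times> nat \<times> nat \<Rightarrow> 'k::field) \<Rightarrow> nat \<times> nat \<times> nat \<Rightarrow> 'k" where
  "commutator_constants c = (\<lambda>(i, j, k). c (i, j, k) - c (j, i, k))"

context based_vector_space
begin

lemma product_of_commutator_constants:
  "product_of (commutator_constants c) = commutator (product_of c)"
proof (intro ext)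
  fix x y
  have "product_of c y x =
      (\<Sum>i = 1..n. \<Sum>j = 1..n. \<Sum>k = 1..n. scale (coord x i * coord y j * c (j, i, k)) (e k))"
    unfolding product_of_def by (subst sum.swap) (simp add: mult_ac)
  then show "product_of (commutator_constants c) x y = commutator (product_of c) x y"
    unfolding commutator_def
    by (simp add: product_of_def commutator_constants_def right_diff_distrib scale_left_diff_distrib
        sum_subtractf)
qed

lemma structure_constants_commutator:
  "structure_constants (commutator \<mu>) = commutator_constants (structure_constants \<mu>)"
proof -
  have "coord (x - y) k = coord x k - coord y k" for x y k
    unfolding coord_def using independent_basis span_basis by (simp add: representation_diff)
  then show ?thesis
    by (auto simp: structure_constants_def commutator_constants_def commutator_def
        indices_def fun_eq_iff)
qed

lemma act_commutator_constants:
  assumes "g \<in> GL"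
  shows "act g (commutator_constants c) = commutator_constants (act g c)"
proof -
  interpret vector_space_pair scale scale
    by unfold_locales
  have "g (x - y) = g x - g y" for x y
    using assms linear_diff unfolding GL_def by blast
  then have "(\<lambda>x y. g (product_of (commutator_constants c) (inv g x) (inv g y))) =
      commutator (\<lambda>x y. g (product_of c (inv g x) (inv g y)))"
    by (simp add: product_of_commutator_constants commutator_def fun_eq_iff)
  then show ?thesis
    by (simp add: act_def structure_constants_commutator)
qed

lemma commutator_constants_orbit: "commutator_constants ` orbit c = orbit (commutator_constants c)"
  unfolding orbit_def image_image by (rule image_cong) (simp_all add: act_commutator_constants)

lemma orbit_subset_affine_space: "orbit c \<subseteq> affine_space indices"
  by (auto simp: orbit_def act_def structure_constants_def affine_space_def)

lemma commutator_constants_affine_space: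
  "c \<in> affine_space indices \<Longrightarrow> commutator_constants c \<in> affine_space indices"
  by (auto simp: affine_space_def commutator_constants_def indices_def)

lemma commutator_constants_coordinate_polynomial:
  assumes "t \<in> indices"
  shows "(\<lambda>c. commutator_constants c t) \<in> polynomial_functions indices"
proof -
  obtain i j k where t: "t = (i, j, k)"
    by (cases t)
  with assms have "(j, i, k) \<in> indices"
    by (auto simp: indices_def)
  with assms have "(\<lambda>c. c (i, j, k) + (-1) * c (j, i, k)) \<in> polynomial_functions indices"
    unfolding t
    by (intro polynomial_functions_add polynomial_functions_mult polynomial_functions_const
        polynomial_functions_var)
  then show ?thesis
    by (simp add: t commutator_constants_def)
qed

lemma commutator_constants_lie_variety:
  assumes "c \<in> pre_lie_variety"
  shows "commutator_constants c \<in> lie_variety"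
  using assms commutator_constants_affine_space pre_lie_algebra.lie_algebra_commutator
  by (auto simp: pre_lie_variety_def lie_variety_def product_of_commutator_constants)

lemma degenerates_in_commutator_constants:
  assumes "degenerates_in pre_lie_variety c d"
  shows "degenerates_in lie_variety (commutator_constants c) (commutator_constants d)"
proof -
  have "commutator_constants d \<in> zariski_closure indices (commutator_constants ` orbit c)"
    using assms polynomial_map_zariski_closure[OF _ orbit_subset_affine_space
        commutator_constants_affine_space commutator_constants_coordinate_polynomial]
    unfolding degenerates_in_def by blast
  then show ?thesis
    using assms commutator_constants_lie_variety
    unfolding degenerates_in_def commutator_constants_orbit by blast
qed

lemma represents_commutator_constants:
  assumes "represents c scaleA multA"
  shows "represents (commutator_constants c) scaleA (commutator multA)"
proof -
  obtain f where f: "Vector_Spaces.linear scaleA scale f" "bij f"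
      "\<And>x y. f (multA x y) = product_of c (f x) (f y)"
    using assms unfolding represents_def by blast
  interpret f: Vector_Spaces.linear scaleA scale f
    by (rule f(1))
  have "f (commutator multA x y) = product_of (commutator_constants c) (f x) (f y)" for x y
    by (simp add: product_of_commutator_constants commutator_def f.diff f(3))
  with f show ?thesis
    unfolding represents_def by blast
qed

lemma lie_degenerates_commutator:
  assumes "pre_lie_degenerates scaleA multA scaleB multB"
  shows "lie_degenerates scaleA (commutator multA) scaleB (commutator multB)"
proof -
  obtain c d where "represents c scaleA multA" "represents d scaleB multB"
      "degenerates_in pre_lie_variety c d"
    using assms unfolding pre_lie_degenerates_def algebra_degenerates_in_def by blast
  then have "represents (commutator_constants c) scaleA (commutator multA)"
      "represents (commutator_constants d) scaleB (commutator multB)"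
      "degenerates_in lie_variety (commutator_constants c) (commutator_constants d)"
    by (simp_all add: represents_commutator_constants degenerates_in_commutator_constants)
  then show ?thesis
    unfolding lie_degenerates_def algebra_degenerates_in_def by blast
qed

end

theorem lemma3p5:
  fixes scale :: "'k::field \<Rightarrow> 'v::ab_group_add \<Rightarrow> 'v" and n :: nat and e :: "nat \<Rightarrow> 'v"
    and scaleA :: "'k \<Rightarrow> 'a::ab_group_add \<Rightarrow> 'a" and multA :: "'a \<Rightarrow> 'a \<Rightarrow> 'a"
    and scaleB :: "'k \<Rightarrow> 'b::ab_group_add \<Rightarrow> 'b" and multB :: "'b \<Rightarrow> 'b \<Rightarrow> 'b"
  assumes "based_vector_space scale n e"
    and "pre_lie_algebra scaleA multA" and "n_dimensional n scaleA"
    and "pre_lie_algebra scaleB multB" and "n_dimensional n scaleB"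
    and "based_vector_space.pre_lie_degenerates scale n e scaleA multA scaleB multB"
  shows "based_vector_space.lie_degenerates scale n e
    scaleA (commutator multA) scaleB (commutator multB)"
  using based_vector_space.lie_degenerates_commutator[OF assms(1) assms(6)] .

end
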